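(* Fix a real number $a>1$ and $N_1,N_2\in\mathbb{N}\cup\{0\}$, and let $f\in C^1_{N_1,N_2}$. Then for each $(x,y)\in X$, $$\lim_{m\to\infty}\frac{\partial}{\partial x}\bigl(\hat{Y}_{m,m,a}(f;x,y)\bigr)=\frac{\partial f(x,y)}{\partial x}\qquad\text{and}\qquad \lim_{m\to\infty}\frac{\partial}{\partial y}\bigl(\hat{Y}_{m,m,a}(f;x,y)\bigr)=\frac{\partial f(x,y)}{\partial y}.$$
   Context: $\mathbb{N}=\{1,2,3,\dots\}$ and $X=[0,\infty)\times[0,\infty)$. Partial derivatives at boundary points of $X$ are one-sided. Weights: $w_0(x)=1$ and $w_N(x)=(1+x^N)^{-1}$ for $N\in\mathbb{N}$, $x\ge 0$; and $w_{N_1,N_2}(x,y)=w_{N_1}(x)w_{N_2}(y)$. $C_{N_1,N_2}$ is the set of all continuous functions $f:X\to\mathbb{R}$ such that $w_{N_1,N_2}f$ is uniformly continuous and bounded on $X$. $C^1_{N_1,N_2}=\{f\in C_{N_1,N_2}:\ \partial f/\partial x,\ \partial f/\partial y\in C_{N_1,N_2}\}$. Operators: for $m\in\mathbb{N}$ and $(x,y)\in X$, $$\hat{Y}_{m,m,a}(f;x,y)=\sum_{k_1=0}^{\infty}\sum_{k_2=0}^{\infty}a^{\frac{-(x+y)}{a^{1/m}-1}}\,\frac{x^{k_1}y^{k_2}(\log a)^{k_1+k_2}}{(a^{1/m}-1)^{k_1+k_2}\,k_1!\,k_2!}\;f\!\left(\frac{k_1}{m},\frac{k_2}{m}\right),$$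 with the convention $0^0=1$. *)

theory Defs
  imports "HOL-Analysis.Analysis"
begin

definition quadrant :: "(real \<times> real) set" where
  "quadrant = {0..} \<times> {0..}"

definition weight :: "nat \<Rightarrow> real \<Rightarrow> real" where
  "weight N x = (if N = 0 then 1 else inverse (1 + x ^ N))"

definition weight2 :: "nat \<Rightarrow> nat \<Rightarrow> real \<times> real \<Rightarrow> real" where
  "weight2 N1 N2 = (\<lambda>(x, y). weight N1 x * weight N2 y)"

text \<open>Functions on the quadrant are represented by total functions on the plane. Everything below
  depends only on their values on the quadrant.\<close>

definition weighted_C :: "nat \<Rightarrow> nat \<Rightarrow> (real \<times> real \<Rightarrow> real) set" where
  "weighted_C N1 N2 = {f. continuous_on quadrant f \<and>
     uniformly_continuous_on quadrant (\<lambda>p. weight2 N1 N2 p * f p) \<and>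
     bounded ((\<lambda>p. weight2 N1 N2 p * f p) ` quadrant)}"

text \<open>Restricting the filter to \<open>{0..}\<close> makes the derivatives one-sided exactly at the boundary
  points. The value of \<open>partial_x f\<close> is meaningful only where \<open>has_partial_x f\<close> holds, and
  likewise for \<open>y\<close>.\<close>

definition has_partial_x :: "(real \<times> real \<Rightarrow> real) \<Rightarrow> real \<times> real \<Rightarrow> bool" where
  "has_partial_x f = (\<lambda>(x, y). (\<lambda>t. f (t, y)) differentiable (at x within {0..}))"

definition has_partial_y :: "(real \<times> real \<Rightarrow> real) \<Rightarrow> real \<times> real \<Rightarrow> bool" where
  "has_partial_y f = (\<lambda>(x, y). (\<lambda>t. f (x, t)) differentiable (at y within {0..}))"

definition partial_x :: "(real \<times> real \<Rightarrow> real) \<Rightarrow> real \<times> real \<Rightarrow> real" where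
  "partial_x f = (\<lambda>(x, y). vector_derivative (\<lambda>t. f (t, y)) (at x within {0..}))"

definition partial_y :: "(real \<times> real \<Rightarrow> real) \<Rightarrow> real \<times> real \<Rightarrow> real" where
  "partial_y f = (\<lambda>(x, y). vector_derivative (\<lambda>t. f (x, t)) (at y within {0..}))"

definition weighted_C1 :: "nat \<Rightarrow> nat \<Rightarrow> (real \<times> real \<Rightarrow> real) set" where
  "weighted_C1 N1 N2 = {f \<in> weighted_C N1 N2.
     (\<forall>p\<in>quadrant. has_partial_x f p \<and> has_partial_y f p) \<and>
     partial_x f \<in> weighted_C N1 N2 \<and> partial_y f \<in> weighted_C N1 N2}"

text \<open>The index \<open>m\<close> is meant to be positive; the value at \<open>m = 0\<close> is a division by zero.\<close>

definition Yhat :: "nat \<Rightarrow> real \<Rightarrow> (real \<times> real \<Rightarrow> real) \<Rightarrow> real \<times> real \<Rightarrow> real" where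
  "Yhat m a f = (\<lambda>(x, y). \<Sum>k1. \<Sum>k2.
     a powr (- (x + y) / (a powr (1 / real m) - 1)) *
     (x ^ k1 * y ^ k2 * ln a ^ (k1 + k2) /
       ((a powr (1 / real m) - 1) ^ (k1 + k2) * fact k1 * fact k2)) *
     f (real k1 / real m, real k2 / real m))"

end

theory Submission
  imports Defs "HOL-Real_Asymp.Real_Asymp"
begin

text \<open>The value of the operator at \<open>(x, y)\<close> is an iterated Poisson average, with parameters
  \<open>c x\<close> and \<open>c y\<close> for \<open>c = ln a / (a powr (1 / m) - 1)\<close>, where \<open>c / m\<close> tends to \<open>1\<close>.
  Differentiating a Poisson average in its parameter averages the forward difference instead,
  which by the mean value theorem is \<open>1 / m\<close> times a value of \<open>\<partial>f / \<partial>x\<close> in the adjacent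
  cell. Since \<open>g = \<partial>f / \<partial>x\<close> is continuous and of at most exponential growth, for each
  \<open>\<epsilon> > 0\<close> there is \<open>K\<close> with
  \<open>\<bar>g (u, v) - g (x, y)\<bar> \<le> \<epsilon> + K ((u - x)\<^sup>2 + (v - y)\<^sup>2) exp (u + v)\<close>, and the
  exponentially weighted second moments of the Poisson distribution, which are explicit, tend to
  \<open>0\<close>. The claim about \<open>y\<close> follows by interchanging the two sums.\<close>

no_notation Infinite_Set_Sum.abs_summable_on (infix \<open>abs'_summable'_on\<close> 50)

section \<open>Poisson averages\<close>

text \<open>Any real \<open>z\<close> is allowed: the averages are differentiated on both sides of
  the parameter 0, and left of it the weights alternate in sign.\<close>

definition poisson :: "real \<Rightarrow> nat \<Rightarrow> real" where
  "poisson z k = exp (- z) * z ^ k / fact k"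

lemma poisson_nonneg: "z \<ge> 0 \<Longrightarrow> poisson z k \<ge> 0"
  by (simp add: poisson_def)

text \<open>The probability generating function, read off from the exponential series at
  \<open>z * s\<close>. With \<open>s = exp (1 / m)\<close> it gives the exponential
  moments.\<close>

lemma poisson_power_sums: "(\<lambda>k. poisson z k * s ^ k) sums exp (z * (s - 1))"
proof -
  have "(\<lambda>k. (z * s) ^ k /\<^sub>R fact k) sums exp (z * s)"
    by (rule exp_converges)
  then have "(\<lambda>k. exp (- z) * ((z * s) ^ k /\<^sub>R fact k)) sums (exp (- z) * exp (z * s))"
    by (rule sums_mult)
  then show ?thesis
    by (simp add: poisson_def power_mult_distrib divide_inverse algebra_simps flip: exp_add)
qed

lemma poisson_sums_1: "poisson z sums 1"
  using poisson_power_sums[of z 1] by simp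

text \<open>A factor \<open>k\<close> cancels against the factorial and shifts the index by one,
  while the term at \<open>k = 0\<close> vanishes. Applied repeatedly, this yields the higher
  moments.\<close>

lemma poisson_sums_times_index:
  assumes "(\<lambda>k. poisson z k * \<phi> (Suc k)) sums L"
  shows "(\<lambda>k. poisson z k * (real k * \<phi> k)) sums (z * L)"
proof -
  have "(\<lambda>k. z * (poisson z k * \<phi> (Suc k))) sums (z * L)"
    using assms by (rule sums_mult)
  moreover have "z * (poisson z k * \<phi> (Suc k)) = poisson z (Suc k) * (real (Suc k) * \<phi> (Suc k))" for k
    by (simp add: poisson_def field_simps del: of_nat_Suc)
  ultimately show ?thesis
    using sums_Suc_iff[of "\<lambda>k. poisson z k * (real k * \<phi> k)"] by simp
qed

lemma poisson_second_moment_sums: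
  "(\<lambda>k. poisson z k * ((real k / m - x)\<^sup>2 * s ^ k)) sums
     (exp (z * (s - 1)) * ((z\<^sup>2 * s\<^sup>2 + z * s) / m\<^sup>2 - 2 * x * z * s / m + x\<^sup>2))"
proof -
  define E where "E = exp (z * (s - 1))"
  have 0: "(\<lambda>k. poisson z k * s ^ k) sums E"
    unfolding E_def by (rule poisson_power_sums)
  have 1: "(\<lambda>k. poisson z k * (real k * s ^ k)) sums (z * (s * E))"
    by (rule poisson_sums_times_index) (use sums_mult[OF 0, of s] in \<open>simp add: mult_ac\<close>)
  \<comment> \<open>For \<open>\<phi> k = k * s ^ k\<close> the shifted summand is
    \<open>(k + 1) * s ^ (k + 1)\<close>, which splits into the two sums already known.\<close>
  have 2: "(\<lambda>k. poisson z k * (real k * (real k * s ^ k))) sums (z * (s * (z * (s * E)) + s * E))"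
    by (rule poisson_sums_times_index)
      (use sums_add[OF sums_mult[OF 1, of s] sums_mult[OF 0, of s]] in \<open>simp add: algebra_simps\<close>)
  have "(\<lambda>k. (1 / m\<^sup>2) * (poisson z k * (real k * (real k * s ^ k)))
      + (- 2 * x / m) * (poisson z k * (real k * s ^ k)) + x\<^sup>2 * (poisson z k * s ^ k)) sums
      ((1 / m\<^sup>2) * (z * (s * (z * (s * E)) + s * E)) + (- 2 * x / m) * (z * (s * E)) + x\<^sup>2 * E)"
    by (intro sums_add sums_mult 0 1 2)
  moreover have "(1 / m\<^sup>2) * (poisson z k * (real k * (real k * s ^ k)))
      + (- 2 * x / m) * (poisson z k * (real k * s ^ k)) + x\<^sup>2 * (poisson z k * s ^ k)
      = poisson z k * ((real k / m - x)\<^sup>2 * s ^ k)" for k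
    by (cases "m = 0") (simp_all add: power2_eq_square field_simps)
  moreover have "(1 / m\<^sup>2) * (z * (s * (z * (s * E)) + s * E)) + (- 2 * x / m) * (z * (s * E)) + x\<^sup>2 * E
      = E * ((z\<^sup>2 * s\<^sup>2 + z * s) / m\<^sup>2 - 2 * x * z * s / m + x\<^sup>2)"
    by (cases "m = 0") (simp_all add: power2_eq_square field_simps)
  ultimately show ?thesis
    unfolding E_def by simp
qed

text \<open>The weights sum to 1, so \<open>g\<close> is its own average and the difference is the
  average of \<open>\<phi> k - g\<close>, dominated termwise by that of \<open>\<psi>\<close>. The
  domination also provides the summability.\<close>

lemma poisson_average_diff_le:
  assumes "z \<ge> 0" "\<And>k. \<bar>\<phi> k - g\<bar> \<le> \<psi> k" "(\<lambda>k. poisson z k * \<psi> k) sums L"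
  shows "\<bar>(\<Sum>k. poisson z k * \<phi> k) - g\<bar> \<le> L"
proof -
  have le: "norm (poisson z k * (\<phi> k - g)) \<le> poisson z k * \<psi> k" for k
    using assms(1,2) by (simp add: abs_mult poisson_nonneg mult_left_mono)
  have L: "summable (\<lambda>k. poisson z k * \<psi> k)" "(\<Sum>k. poisson z k * \<psi> k) = L"
    using assms(3) by (auto simp: sums_iff)
  have sm: "summable (\<lambda>k. poisson z k * (\<phi> k - g))"
    by (rule summable_comparison_test'[OF L(1)]) (rule le)
  have "(\<lambda>k. poisson z k * (\<phi> k - g) + g * poisson z k) sums ((\<Sum>k. poisson z k * (\<phi> k - g)) + g * 1)"
    by (intro sums_add summable_sums sm sums_mult poisson_sums_1)
  then have "(\<Sum>k. poisson z k * \<phi> k) - g = (\<Sum>k. poisson z k * (\<phi> k - g))"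
    by (simp add: sums_iff algebra_simps)
  also have "\<bar>\<dots>\<bar> \<le> (\<Sum>k. poisson z k * \<psi> k)"
    using norm_suminf_le[OF le L(1)] by simp
  finally show ?thesis
    using L(2) by simp
qed

lemma poisson_average_bound:
  assumes "z \<ge> 0" "\<And>k. \<bar>\<phi> k\<bar> \<le> M * s ^ k"
  shows "\<bar>\<Sum>k. poisson z k * \<phi> k\<bar> \<le> M * exp (z * (s - 1))"
  using poisson_average_diff_le[of z \<phi> 0 "\<lambda>k. M * s ^ k" "M * exp (z * (s - 1))"]
    assms sums_mult[OF poisson_power_sums, of M z s] by (simp add: mult_ac)

text \<open>The comparison series has parameter \<open>\<bar>z\<bar>\<close>, where the weights are
  nonnegative; the prefactor \<open>exp (- z - - \<bar>z\<bar>)\<close> exchanges the normalization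
  \<open>exp (- \<bar>z\<bar>)\<close> for \<open>exp (- z)\<close>.\<close>

lemma summable_abs_poisson:
  assumes "\<And>k. \<bar>\<phi> k\<bar> \<le> M * s ^ k"
  shows "summable (\<lambda>k. \<bar>poisson z k * \<phi> k\<bar>)"
proof (rule summable_comparison_test')
  show "summable (\<lambda>k. exp (- z - - \<bar>z\<bar>) * M * (poisson \<bar>z\<bar> k * s ^ k))"
    by (intro summable_mult sums_summable[OF poisson_power_sums])
  fix k
  have "\<bar>poisson z k * \<phi> k\<bar> = exp (- z) * \<bar>z\<bar> ^ k / fact k * \<bar>\<phi> k\<bar>"
    by (simp add: poisson_def abs_mult power_abs)
  also have "\<dots> \<le> exp (- z) * \<bar>z\<bar> ^ k / fact k * (M * s ^ k)"
    by (intro mult_left_mono assms) auto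
  also have "\<dots> = exp (- z - - \<bar>z\<bar>) * M * (poisson \<bar>z\<bar> k * s ^ k)"
    unfolding poisson_def exp_diff by (simp add: field_simps)
  finally show "norm \<bar>poisson z k * \<phi> k\<bar> \<le> exp (- z - - \<bar>z\<bar>) * M * (poisson \<bar>z\<bar> k * s ^ k)"
    by simp
qed

lemma summable_poisson:
  assumes "\<And>k. \<bar>\<phi> k\<bar> \<le> M * s ^ k"
  shows "summable (\<lambda>k. poisson z k * \<phi> k)"
  using summable_abs_poisson[OF assms] by (rule summable_rabs_cancel)

text \<open>The average is \<open>exp (- z)\<close> times an everywhere convergent power series at
  \<open>z = c * t\<close>. Differentiating the series shifts the values of \<open>\<phi>\<close>,
  differentiating the exponential subtracts the average itself, and together they leave the forward
  difference.\<close>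

lemma poisson_average_has_derivative:
  assumes bd: "\<And>k. \<bar>\<phi> k\<bar> \<le> M * s ^ k"
  shows "((\<lambda>t. \<Sum>k. poisson (c * t) k * \<phi> k) has_field_derivative
           c * (\<Sum>k. poisson (c * t) k * (\<phi> (Suc k) - \<phi> k))) (at t)"
proof -
  define F where "F z = (\<Sum>k. \<phi> k / fact k * z ^ k)" for z
  define G where "G z = (\<Sum>k. \<phi> (Suc k) / fact k * z ^ k)" for z
  have unscale: "\<psi> k / fact k * z ^ k = exp z * (poisson z k * \<psi> k)" for \<psi> z k
    by (simp add: poisson_def exp_minus)
  have bd': "\<bar>\<phi> (Suc k)\<bar> \<le> (M * s) * s ^ k" for k
    using bd[of "Suc k"] by (simp add: mult_ac)
  have sF: "summable (\<lambda>k. \<phi> k / fact k * z ^ k)" for z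
    unfolding unscale by (intro summable_mult summable_poisson[OF bd])
  \<comment> \<open>The factor \<open>k + 1\<close> from differentiation cancels against
    \<open>fact (Suc k)\<close>.\<close>
  have "diffs (\<lambda>k. \<phi> k / fact k) = (\<lambda>k. \<phi> (Suc k) / fact k)"
    by (auto simp: diffs_def field_simps simp del: of_nat_Suc)
  then have derF: "(F has_field_derivative G z) (at z)" for z
    using termdiffs_strong_converges_everywhere[OF sF, of z] unfolding F_def G_def by simp
  have der: "((\<lambda>t. exp (- (c * t)) * F (c * t)) has_field_derivative
      exp (- (c * t)) * (G (c * t) * c) + (exp (- (c * t)) * - c) * F (c * t)) (at t)"
    by (auto intro!: derivative_eq_intros DERIV_chain'[of _ _ t UNIV F] derF)
  have comb: "exp (- (c * t)) * (G (c * t) * c) + (exp (- (c * t)) * - c) * F (c * t)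
      = c * (exp (- (c * t)) * G (c * t) - exp (- (c * t)) * F (c * t))"
    by (simp add: algebra_simps)
  have avgF: "exp (- (c * u)) * F (c * u) = (\<Sum>k. poisson (c * u) k * \<phi> k)" for u
    unfolding F_def unscale suminf_mult[OF summable_poisson[OF bd]]
    by (simp add: exp_minus)
  have avgG: "exp (- (c * t)) * G (c * t) = (\<Sum>k. poisson (c * t) k * \<phi> (Suc k))"
    unfolding G_def unscale[of "\<lambda>k. \<phi> (Suc k)"] suminf_mult[OF summable_poisson[OF bd']]
    by (simp add: exp_minus)
  have avg_diff: "(\<Sum>k. poisson (c * t) k * (\<phi> (Suc k) - \<phi> k))
      = (\<Sum>k. poisson (c * t) k * \<phi> (Suc k)) - (\<Sum>k. poisson (c * t) k * \<phi> k)"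
    unfolding right_diff_distrib
    by (rule suminf_diff[OF summable_poisson[OF bd'] summable_poisson[OF bd], symmetric])
  show ?thesis
    using der unfolding comb avgF avgG avg_diff .
qed

section \<open>Interchange of iterated sums\<close>

lemma abs_summable_on_times:
  fixes u :: "'a \<Rightarrow> real" and v :: "'b \<Rightarrow> real"
  assumes "u summable_on A" "v summable_on B"
  shows "(\<lambda>(x, y). u x * v y) abs_summable_on A \<times> B"
proof -
  have u: "(\<lambda>x. \<bar>u x\<bar>) summable_on A" and v: "(\<lambda>y. \<bar>v y\<bar>) summable_on B"
    using assms by (auto simp flip: summable_on_iff_abs_summable_on_real[unfolded real_norm_def])
  show ?thesis
    unfolding Infinite_Sum.abs_summable_on_Sigma_iff
    using u v
    by (auto simp: abs_mult infsum_cmult_right infsum_nonneg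
        intro!: summable_on_cmult_right summable_on_cmult_left)
qed

text \<open>Domination by a product of summable sequences makes \<open>F\<close> absolutely summable
  over all pairs, where Fubini's theorem for unordered sums applies.\<close>

lemma suminf_swap:
  fixes F :: "nat \<Rightarrow> nat \<Rightarrow> real"
  assumes u: "summable u" and v: "summable v"
    and le: "\<And>k l. \<bar>F k l\<bar> \<le> u k * v l" and nonneg: "\<And>k. 0 \<le> u k" "\<And>k. 0 \<le> v k"
  shows "(\<Sum>k. \<Sum>l. F k l) = (\<Sum>l. \<Sum>k. F k l)"
proof -
  have "(\<lambda>(k, l). u k * v l) abs_summable_on UNIV \<times> UNIV"
    using u v nonneg by (intro abs_summable_on_times) (auto simp: summable_on_UNIV_nonneg_real_iff)
  then have abs: "(\<lambda>(k, l). F k l) abs_summable_on UNIV \<times> UNIV"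
    using le nonneg by (elim Infinite_Sum.abs_summable_on_comparison_test) (auto simp: abs_mult)
  then have abs': "(\<lambda>(l, k). F k l) abs_summable_on UNIV \<times> UNIV"
    using summable_on_swap[of "\<lambda>x. norm (case x of (k, l) \<Rightarrow> F k l)" UNIV UNIV]
    by (simp add: case_prod_unfold)
  \<comment> \<open>Absolute summability over pairs makes every row and the sequence of row sums
    summable, so each ordered series equals the unordered sum.\<close>
  have eq: "(\<Sum>k. \<Sum>l. H k l) = (\<Sum>\<^sub>\<infinity>k. \<Sum>\<^sub>\<infinity>l. H k l)"
    if H: "(\<lambda>(k, l). H k l) abs_summable_on UNIV \<times> UNIV" for H :: "nat \<Rightarrow> nat \<Rightarrow> real"
  proof -
    have inf: "suminf h = infsum h UNIV" if "h summable_on UNIV" for h :: "nat \<Rightarrow> real"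
      using has_sum_imp_sums[OF has_sum_infsum[OF that]] by (simp add: sums_iff)
    have sm: "(\<lambda>(k, l). H k l) summable_on UNIV \<times> UNIV"
      using H by (rule Infinite_Sum.abs_summable_summable)
    have "H k summable_on UNIV" for k
      using H unfolding Infinite_Sum.abs_summable_on_Sigma_iff by (auto intro: Infinite_Sum.abs_summable_summable)
    then have "(\<Sum>k. \<Sum>l. H k l) = (\<Sum>k. \<Sum>\<^sub>\<infinity>l. H k l)"
      by (simp add: inf)
    also have "\<dots> = (\<Sum>\<^sub>\<infinity>k. \<Sum>\<^sub>\<infinity>l. H k l)"
      using summable_on_Sigma_banach[OF sm] by (rule inf)
    finally show ?thesis .
  qed
  show ?thesis
    unfolding eq[OF abs] eq[OF abs', simplified]
    by (rule infsum_swap_banach[OF Infinite_Sum.abs_summable_summable[OF abs]])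
qed

lemma poisson_average_swap:
  assumes bd: "\<And>k l. \<bar>F k l\<bar> \<le> M * s ^ k * s ^ l" and "s \<ge> 0"
  shows "(\<Sum>k. poisson z k * (\<Sum>l. poisson w l * F k l)) =
         (\<Sum>l. poisson w l * (\<Sum>k. poisson z k * F k l))"
proof -
  have M: "M \<ge> 0"
    using bd[of 0 0] by simp
  have bd': "\<bar>F k l\<bar> \<le> (M * s ^ l) * s ^ k" for k l
    using bd[of k l] by (simp add: mult_ac)
  have "(\<Sum>k. poisson z k * (\<Sum>l. poisson w l * F k l)) =
      (\<Sum>k. \<Sum>l. poisson z k * (poisson w l * F k l))"
    by (intro suminf_cong suminf_mult[symmetric] summable_poisson[OF bd])
  also have "\<dots> = (\<Sum>l. \<Sum>k. poisson z k * (poisson w l * F k l))"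
  proof (rule suminf_swap)
    show "summable (\<lambda>k. M * \<bar>poisson z k * s ^ k\<bar>)" "summable (\<lambda>l. \<bar>poisson w l * s ^ l\<bar>)"
      using \<open>s \<ge> 0\<close> by (auto intro!: summable_mult summable_abs_poisson[of _ 1 s])
    show "\<bar>poisson z k * (poisson w l * F k l)\<bar> \<le> M * \<bar>poisson z k * s ^ k\<bar> * \<bar>poisson w l * s ^ l\<bar>" for k l
      using mult_left_mono[OF bd, of "\<bar>poisson z k\<bar> * \<bar>poisson w l\<bar>" k l] \<open>s \<ge> 0\<close>
      by (simp add: abs_mult mult_ac)
  qed (use M in auto)
  also have "\<dots> = (\<Sum>l. poisson w l * (\<Sum>k. poisson z k * F k l))"
    using suminf_mult[OF summable_poisson[of "\<lambda>k. F k _", OF bd'], of "poisson w _" z] by (simp add: mult_ac)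
  finally show ?thesis .
qed

section \<open>The operator as an iterated Poisson average\<close>

definition rate :: "real \<Rightarrow> nat \<Rightarrow> real" where
  "rate a m = ln a / (a powr (1 / real m) - 1)"

lemma rate_nonneg:
  assumes "a > 1" "m \<ge> 1"
  shows "rate a m \<ge> 0"
  using assms powr_mono[of 0 "1 / real m" a] by (simp add: rate_def)

text \<open>With \<open>h = ln a / m\<close> the quotient is \<open>h / (exp h - 1)\<close>, and
  \<open>h\<close> tends to 0.\<close>

lemma rate_over_index_tendsto:
  assumes "a > 1"
  shows "(\<lambda>m. rate a m / real m) \<longlonglongrightarrow> 1"
proof -
  have "ln a > 0"
    using assms by simp
  then have "((\<lambda>m. ln a / (exp (ln a / real m) - 1) / real m) \<longlongrightarrow> 1) at_top"
    by real_asymp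
  moreover have "rate a m = ln a / (exp (ln a / real m) - 1)" for m
    using assms by (simp add: rate_def powr_def)
  ultimately show ?thesis
    by simp
qed

text \<open>On the grid, exponential growth becomes geometric growth with ratio
  \<open>exp (1 / m)\<close> in each index, the form used for Poisson averages.\<close>

lemma exp_growth_grid:
  assumes "\<And>u v. u \<ge> 0 \<Longrightarrow> v \<ge> 0 \<Longrightarrow> \<bar>f (u, v)\<bar> \<le> M * exp (u + v)"
  shows "\<bar>f (real k / real m, real l / real m)\<bar> \<le> M * exp (1 / real m) ^ k * exp (1 / real m) ^ l"
  using assms[of "real k / real m" "real l / real m"]
  by (simp add: exp_add mult.assoc flip: exp_of_nat_mult)

text \<open>The power of \<open>a\<close> and the monomials factor into Poisson weights; the growth
  bound serves to pull the weight of \<open>k\<close> out of the inner sum. All real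
  \<open>x\<close> and \<open>y\<close> are covered, so that a two-sided derivative can be taken at
  0.\<close>

lemma Yhat_eq_poisson:
  assumes a: "a > 1" and m: "m \<ge> 1"
    and bd: "\<And>u v. u \<ge> 0 \<Longrightarrow> v \<ge> 0 \<Longrightarrow> \<bar>f (u, v)\<bar> \<le> M * exp (u + v)"
  shows "Yhat m a f (x, y) = (\<Sum>k. poisson (rate a m * x) k *
           (\<Sum>l. poisson (rate a m * y) l * f (real k / real m, real l / real m)))"
proof -
  define d where "d = a powr (1 / real m) - 1"
  define c where "c = rate a m"
  have c: "c = ln a / d"
    by (simp add: c_def rate_def d_def)
  have "a powr (- (x + y) / d) = exp (- (c * x)) * exp (- (c * y))"
    using a by (simp add: powr_def c diff_divide_distrib algebra_simps flip: exp_add)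
  moreover have "x ^ k * y ^ l * ln a ^ (k + l) / (d ^ (k + l) * fact k * fact l)
      = (c * x) ^ k / fact k * ((c * y) ^ l / fact l)" for k l
    by (simp add: c power_add power_mult_distrib power_divide mult_ac)
  ultimately have weight: "a powr (- (x + y) / d) * (x ^ k * y ^ l * ln a ^ (k + l) / (d ^ (k + l) * fact k * fact l))
      = poisson (c * x) k * poisson (c * y) l" for k l
    by (simp add: poisson_def)
  have "Yhat m a f (x, y) = (\<Sum>k. \<Sum>l. poisson (rate a m * x) k *
      (poisson (rate a m * y) l * f (real k / real m, real l / real m)))"
    unfolding Yhat_def prod.case d_def[symmetric] c_def[symmetric] weight by (simp only: mult.assoc)
  then show ?thesis
    by (simp add: suminf_mult summable_poisson[OF exp_growth_grid[OF bd]])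
qed

text \<open>Reflecting \<open>f\<close> amounts to interchanging the order of summation. This
  carries results on the first variable over to the second.\<close>

lemma Yhat_swap:
  assumes a: "a > 1" and m: "m \<ge> 1"
    and bd: "\<And>u v. u \<ge> 0 \<Longrightarrow> v \<ge> 0 \<Longrightarrow> \<bar>f (u, v)\<bar> \<le> M * exp (u + v)"
  shows "Yhat m a (\<lambda>(u, v). f (v, u)) (y, x) = Yhat m a f (x, y)"
proof -
  have bd': "\<bar>(\<lambda>(u, v). f (v, u)) (u, v)\<bar> \<le> M * exp (u + v)" if "u \<ge> 0" "v \<ge> 0" for u v
    using bd[OF that(2,1)] by (simp add: add.commute)
  show ?thesis
    using Yhat_eq_poisson[OF a m bd, of x y] Yhat_eq_poisson[of a m "\<lambda>(u, v). f (v, u)" M y x, OF a m bd']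
      poisson_average_swap[OF exp_growth_grid[OF bd], of m "rate a m * x" "rate a m * y"]
    by simp
qed

text \<open>In its first variable the operator is the Poisson average of the inner averages
  \<open>h k\<close>, which inherit geometric growth in \<open>k\<close>. The derivative is
  two-sided, also at \<open>x = 0\<close>.\<close>

lemma Yhat_has_derivative_x:
  assumes a: "a > 1" and m: "m \<ge> 1" and y: "y \<ge> 0"
    and bd: "\<And>u v. u \<ge> 0 \<Longrightarrow> v \<ge> 0 \<Longrightarrow> \<bar>f (u, v)\<bar> \<le> M * exp (u + v)"
  shows "((\<lambda>t. Yhat m a f (t, y)) has_field_derivative
     rate a m * (\<Sum>k. poisson (rate a m * x) k * (\<Sum>l. poisson (rate a m * y) l *
       (f (real (Suc k) / real m, real l / real m) - f (real k / real m, real l / real m))))) (at x)"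
proof -
  define s where "s = exp (1 / real m)"
  define c where "c = rate a m"
  define h where "h k = (\<Sum>l. poisson (c * y) l * f (real k / real m, real l / real m))" for k
  have cy: "c * y \<ge> 0"
    using rate_nonneg[OF a m] y by (simp add: c_def)
  have grid: "\<bar>f (real k / real m, real l / real m)\<bar> \<le> M * s ^ k * s ^ l" for k l
    unfolding s_def by (rule exp_growth_grid[OF bd])
  have "\<bar>h k\<bar> \<le> (M * exp (c * y * (s - 1))) * s ^ k" for k
    using poisson_average_bound[OF cy grid, of k] by (simp add: h_def mult_ac)
  from poisson_average_has_derivative[OF this, of c x]
  have "((\<lambda>t. \<Sum>k. poisson (c * t) k * h k) has_field_derivative
      c * (\<Sum>k. poisson (c * x) k * (h (Suc k) - h k))) (at x)" .
  moreover have "h (Suc k) - h k = (\<Sum>l. poisson (c * y) l *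
       (f (real (Suc k) / real m, real l / real m) - f (real k / real m, real l / real m)))" for k
    unfolding h_def right_diff_distrib
    by (rule suminf_diff[OF summable_poisson[OF grid] summable_poisson[OF grid]])
  ultimately show ?thesis
    by (simp add: Yhat_eq_poisson[OF a m bd] c_def h_def del: of_nat_Suc)
qed

section \<open>Convergence of the partial derivatives\<close>

text \<open>Within distance \<open>\<delta>\<close> of \<open>(x, y)\<close> continuity gives
  \<open>\<epsilon>\<close>. Farther away the squared distance is at least
  \<open>\<delta>\<^sup>2\<close>, so a large enough \<open>K\<close> absorbs the crude growth
  bound.\<close>

lemma exp_growth_local_estimate:
  fixes g :: "real \<times> real \<Rightarrow> real"
  assumes cont: "continuous_on quadrant g" and "x \<ge> 0" "y \<ge> 0" and "\<epsilon> > 0"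
    and bd: "\<And>u v. u \<ge> 0 \<Longrightarrow> v \<ge> 0 \<Longrightarrow> \<bar>g (u, v)\<bar> \<le> M * exp (u + v)"
  obtains K where "K \<ge> 0"
    "\<And>u v. u \<ge> 0 \<Longrightarrow> v \<ge> 0 \<Longrightarrow>
       \<bar>g (u, v) - g (x, y)\<bar> \<le> \<epsilon> + K * ((u - x)\<^sup>2 + (v - y)\<^sup>2) * exp (u + v)"
proof -
  have "(x, y) \<in> quadrant"
    using assms by (simp add: quadrant_def)
  with cont \<open>\<epsilon> > 0\<close> obtain \<delta> where \<delta>: "\<delta> > 0"
      "\<And>q. q \<in> quadrant \<Longrightarrow> dist q (x, y) < \<delta> \<Longrightarrow> dist (g q) (g (x, y)) < \<epsilon>"
    unfolding continuous_on_iff by metis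
  have M: "M \<ge> 0"
    using bd[of 0 0] by simp
  \<comment> \<open>Chosen so that
    \<open>M * exp (u + v) + M * exp (x + y) \<le> B * exp (u + v)\<close>, by
    \<open>exp (u + v) \<ge> 1\<close>.\<close>
  define B where "B = M * (1 + exp (x + y))"
  have B: "B \<ge> 0"
    using M by (simp add: B_def)
  show ?thesis
  proof
    show K: "B / \<delta>\<^sup>2 \<ge> 0"
      using B by simp
    fix u v :: real
    assume uv: "u \<ge> 0" "v \<ge> 0"
    let ?r = "(u - x)\<^sup>2 + (v - y)\<^sup>2"
    have pos: "B / \<delta>\<^sup>2 * ?r * exp (u + v) \<ge> 0"
      using K by (intro mult_nonneg_nonneg) auto
    show "\<bar>g (u, v) - g (x, y)\<bar> \<le> \<epsilon> + B / \<delta>\<^sup>2 * ?r * exp (u + v)"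
    proof (cases "dist (u, v) (x, y) < \<delta>")
      case True
      then show ?thesis
        using \<delta>(2)[of "(u, v)"] uv pos by (simp add: quadrant_def dist_real_def)
    next
      case False
      then have "\<delta> \<le> sqrt ?r"
        by (simp add: dist_Pair_Pair dist_real_def)
      then have "\<delta>\<^sup>2 \<le> ?r"
        using \<delta>(1) by (metis less_eq_real_def real_le_rsqrt real_sqrt_le_iff real_sqrt_unique order_trans sqrt_ge_absD abs_of_pos)
      then have "1 \<le> ?r / \<delta>\<^sup>2"
        using \<delta>(1) by simp
      have "\<bar>g (u, v) - g (x, y)\<bar> \<le> M * exp (u + v) + M * exp (x + y) * 1"
        using bd[OF uv] bd[OF assms(2,3)] by linarith
      also have "\<dots> \<le> M * exp (u + v) + M * exp (x + y) * exp (u + v)"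
        using M uv by (intro add_left_mono mult_left_mono) auto
      also have "\<dots> = B * exp (u + v) * 1"
        by (simp add: B_def algebra_simps)
      also have "\<dots> \<le> B * exp (u + v) * (?r / \<delta>\<^sup>2)"
        using B \<open>1 \<le> ?r / \<delta>\<^sup>2\<close> by (intro mult_left_mono) auto
      finally show ?thesis
        using \<open>\<epsilon> > 0\<close> by (simp add: mult_ac)
    qed
  qed
qed

text \<open>For \<open>k\<close> Poisson distributed with mean \<open>rate a m * x\<close>, the next two constants are the
  expectations of \<open>exp (k / m)\<close> and of \<open>(k / m - x)\<^sup>2 exp (k / m)\<close>.\<close>

definition exp_moment :: "real \<Rightarrow> nat \<Rightarrow> real \<Rightarrow> real" where
  "exp_moment a m x = exp (rate a m * x * (exp (1 / real m) - 1))"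

definition exp_second_moment :: "real \<Rightarrow> nat \<Rightarrow> real \<Rightarrow> real" where
  "exp_second_moment a m x = exp_moment a m x *
     (((rate a m * x)\<^sup>2 * (exp (1 / real m))\<^sup>2 + rate a m * x * exp (1 / real m)) / (real m)\<^sup>2
      - 2 * x * (rate a m * x) * exp (1 / real m) / real m + x\<^sup>2)"

lemma exp_moment_tendsto:
  assumes "a > 1"
  shows "(\<lambda>m. exp_moment a m x) \<longlonglongrightarrow> exp x"
proof -
  have "((\<lambda>m. real m * (exp (1 / real m) - 1)) \<longlongrightarrow> 1) at_top"
    by real_asymp
  \<comment> \<open>The exponent is regrouped by inserting \<open>1 / m\<close> and
    \<open>m\<close>, which gives two factors with limit 1.\<close>
  then have "(\<lambda>m. exp (rate a m / real m * x * (real m * (exp (1 / real m) - 1)))) \<longlonglongrightarrow> exp (1 * x * 1)"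
    by (intro tendsto_intros rate_over_index_tendsto assms)
  then have "(\<lambda>m. exp (rate a m / real m * x * (real m * (exp (1 / real m) - 1)))) \<longlonglongrightarrow> exp x"
    by simp
  then show ?thesis
    by (rule Lim_transform_eventually)
      (auto simp: exp_moment_def eventually_sequentially intro!: exI[of _ 1])
qed

text \<open>Since \<open>rate a m / m\<close> and \<open>exp (1 / m)\<close> tend to 1, the bracket
  tends to \<open>x\<^sup>2 - 2 * x\<^sup>2 + x\<^sup>2 = 0\<close>; the term linear in
  \<open>rate a m * x\<close> and divided by \<open>m\<^sup>2\<close> is of order
  \<open>1 / m\<close>.\<close>

lemma exp_second_moment_tendsto:
  assumes "a > 1"
  shows "(\<lambda>m. exp_second_moment a m x) \<longlonglongrightarrow> 0"
proof -
  let ?r = "\<lambda>m. rate a m / real m" and ?s = "\<lambda>m. exp (1 / real m)"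
  have s: "(?s \<longlongrightarrow> 1) at_top" and i: "((\<lambda>m. 1 / real m) \<longlongrightarrow> 0) at_top"
    by real_asymp+
  have "(\<lambda>m. exp_moment a m x * (?r m ^ 2 * x ^ 2 * ?s m ^ 2 + ?r m * x * ?s m * (1 / real m)
      - 2 * x * ?r m * x * ?s m + x\<^sup>2)) \<longlonglongrightarrow>
      exp x * (1 ^ 2 * x ^ 2 * 1 ^ 2 + 1 * x * 1 * 0 - 2 * x * 1 * x * 1 + x\<^sup>2)"
    by (intro tendsto_intros rate_over_index_tendsto exp_moment_tendsto assms s i)
  moreover have "exp_moment a m x * (?r m ^ 2 * x ^ 2 * ?s m ^ 2 + ?r m * x * ?s m * (1 / real m)
      - 2 * x * ?r m * x * ?s m + x\<^sup>2) = exp_second_moment a m x" for m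
    by (simp add: exp_second_moment_def add_divide_distrib power2_eq_square mult_ac)
  ultimately show ?thesis
    by (simp add: power2_eq_square)
qed

text \<open>The factor \<open>2\<close> and the summand \<open>1 / m\<^sup>2\<close> in the bound absorb the distance of the
  mean-value point of a cell to the lattice point at its left end.\<close>

lemma forward_difference_estimate:
  assumes m: "m \<ge> 1" and v: "v \<ge> 0" and K: "K \<ge> 0"
    and der: "\<And>u. u \<ge> 0 \<Longrightarrow> ((\<lambda>t. f (t, v)) has_field_derivative g (u, v)) (at u within {0..})"
    and est: "\<And>u. u \<ge> 0 \<Longrightarrow> \<bar>g (u, v) - b\<bar> \<le> \<epsilon> + K * ((u - x)\<^sup>2 + (v - y)\<^sup>2) * exp (u + v)"
  shows "\<bar>real m * (f (real (Suc k) / real m, v) - f (real k / real m, v)) - b\<bar> \<le>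
     \<epsilon> + 2 * K * exp 1 * ((real k / real m - x)\<^sup>2 + (1 / real m)\<^sup>2 + (v - y)\<^sup>2) *
       exp (real k / real m + v)"
proof -
  define p where "p = real k / real m"
  have p: "p \<ge> 0" "real (Suc k) / real m = p + 1 / real m" "1 / real m \<ge> 0" "1 / real m \<le> 1"
    using m by (auto simp: p_def add_divide_distrib)
  \<comment> \<open>Restricted to a single cell, the one-sided derivatives suffice for the mean
    value theorem, including the cell that starts at 0.\<close>
  have "((\<lambda>t. f (t, v)) has_derivative (*) (g (u, v))) (at u within {p..p + 1 / real m})"
    if "p \<le> u" "u \<le> p + 1 / real m" for u
    using has_field_derivative_subset[OF der[of u], of "{p..p + 1 / real m}"] that p
    by (auto simp: has_field_derivative_def)
  from mvt_very_simple[OF _ this] p(3)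
  obtain \<xi> where \<xi>: "p \<le> \<xi>" "\<xi> \<le> p + 1 / real m"
      and eq: "f (p + 1 / real m, v) - f (p, v) = g (\<xi>, v) / real m"
    by auto
  have "(\<xi> - x)\<^sup>2 = ((p - x) + (\<xi> - p))\<^sup>2"
    by simp
  also have "\<dots> \<le> 2 * (p - x)\<^sup>2 + 2 * (\<xi> - p)\<^sup>2"
    using sum_squares_bound[of "p - x" "\<xi> - p"] unfolding power2_sum by linarith
  finally have "(\<xi> - x)\<^sup>2 \<le> 2 * (p - x)\<^sup>2 + 2 * (\<xi> - p)\<^sup>2" .
  moreover have "(\<xi> - p)\<^sup>2 \<le> (1 / real m)\<^sup>2"
    using \<xi> by (intro power_mono) auto
  ultimately have sq: "(\<xi> - x)\<^sup>2 + (v - y)\<^sup>2 \<le> 2 * ((p - x)\<^sup>2 + (1 / real m)\<^sup>2 + (v - y)\<^sup>2)"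
    using zero_le_power2[of "v - y"] unfolding distrib_left by argo
  \<comment> \<open>The point \<open>\<xi>\<close> exceeds \<open>p\<close> by at most
    \<open>1 / m \<le> 1\<close>, whence the factor \<open>exp 1\<close>.\<close>
  have ex: "exp (\<xi> + v) \<le> exp 1 * exp (p + v)"
    using \<xi> p(4) by (simp flip: exp_add)
  have "\<bar>g (\<xi>, v) - b\<bar> \<le> \<epsilon> + K * (((\<xi> - x)\<^sup>2 + (v - y)\<^sup>2) * exp (\<xi> + v))"
    using est[of \<xi>] \<xi> p(1) by (simp add: mult.assoc)
  also have "\<dots> \<le> \<epsilon> + K * ((2 * ((p - x)\<^sup>2 + (1 / real m)\<^sup>2 + (v - y)\<^sup>2)) * (exp 1 * exp (p + v)))"
    using K by (intro add_left_mono mult_left_mono mult_mono sq ex) auto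
  finally show ?thesis
    using m unfolding p(2) p_def[symmetric] eq by (simp add: mult_ac)
qed

text \<open>The bound is a sum of terms that are each a function of \<open>k\<close> times a
  function of \<open>l\<close>. Averaging over \<open>l\<close> with \<open>k\<close> fixed and then
  over \<open>k\<close> replaces each factor by its moment.\<close>

lemma iterated_poisson_average_estimate:
  fixes \<epsilon> b K x y :: real
  assumes a: "a > 1" and m: "m \<ge> 1" and x: "x \<ge> 0" and y: "y \<ge> 0"
    and est: "\<And>k l. \<bar>q k l - b\<bar> \<le>
      \<epsilon> + K * ((real k / real m - x)\<^sup>2 + (1 / real m)\<^sup>2 + (real l / real m - y)\<^sup>2) *
        exp (real k / real m + real l / real m)"
  shows "\<bar>(\<Sum>k. poisson (rate a m * x) k * (\<Sum>l. poisson (rate a m * y) l * q k l)) - b\<bar> \<le>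
     \<epsilon> + K * ((exp_second_moment a m x + (1 / real m)\<^sup>2 * exp_moment a m x) * exp_moment a m y
       + exp_moment a m x * exp_second_moment a m y)"
proof -
  define s where "s = exp (1 / real m)"
  define Q where "Q = (\<lambda>z k. (real k / real m - z)\<^sup>2 * s ^ k)"
  define E V where "E = exp_moment a m" and "V = exp_second_moment a m"
  define P where "P = (\<lambda>z. poisson (rate a m * z))"
  have P: "P z sums 1" "(\<lambda>k. P z k * s ^ k) sums E z" "(\<lambda>k. P z k * Q z k) sums V z" for z
    unfolding P_def E_def V_def Q_def s_def exp_second_moment_def exp_moment_def
    by (rule poisson_sums_1 poisson_power_sums poisson_second_moment_sums)+
  have pos: "rate a m * x \<ge> 0" "rate a m * y \<ge> 0"
    using rate_nonneg[OF a m] x y by auto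
  have est': "\<bar>q k l - b\<bar> \<le> \<epsilon> + K * ((Q x k + (1 / real m)\<^sup>2 * s ^ k) * s ^ l + s ^ k * Q y l)" for k l
  proof -
    have "exp (real k / real m + real l / real m) = s ^ k * s ^ l"
      by (simp add: s_def exp_add flip: exp_of_nat_mult)
    then show ?thesis
      using est[of k l] by (simp add: Q_def algebra_simps)
  qed
  have inner: "\<bar>(\<Sum>l. P y l * q k l) - b\<bar> \<le> \<epsilon> + K * ((Q x k + (1 / real m)\<^sup>2 * s ^ k) * E y + s ^ k * V y)" for k
    unfolding P_def
  proof (rule poisson_average_diff_le[OF pos(2) est'])
    have "(\<lambda>l. \<epsilon> * P y l + K * ((Q x k + (1 / real m)\<^sup>2 * s ^ k) * (P y l * s ^ l) + s ^ k * (P y l * Q y l)))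
        sums (\<epsilon> * 1 + K * ((Q x k + (1 / real m)\<^sup>2 * s ^ k) * E y + s ^ k * V y))"
      by (intro sums_add sums_mult P)
    then show "(\<lambda>l. poisson (rate a m * y) l * (\<epsilon> + K * ((Q x k + (1 / real m)\<^sup>2 * s ^ k) * s ^ l + s ^ k * Q y l)))
        sums (\<epsilon> + K * ((Q x k + (1 / real m)\<^sup>2 * s ^ k) * E y + s ^ k * V y))"
      by (simp add: P_def algebra_simps)
  qed
  have "\<bar>(\<Sum>k. P x k * (\<Sum>l. P y l * q k l)) - b\<bar> \<le>
      \<epsilon> + K * ((V x + (1 / real m)\<^sup>2 * E x) * E y + E x * V y)"
    unfolding P_def
  proof (rule poisson_average_diff_le[OF pos(1) inner[unfolded P_def]])
    have "(\<lambda>k. \<epsilon> * P x k + K * (E y * (P x k * Q x k + (1 / real m)\<^sup>2 * (P x k * s ^ k)) + V y * (P x k * s ^ k)))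
        sums (\<epsilon> * 1 + K * (E y * (V x + (1 / real m)\<^sup>2 * E x) + V y * E x))"
      by (intro sums_add sums_mult P)
    then show "(\<lambda>k. poisson (rate a m * x) k * (\<epsilon> + K * ((Q x k + (1 / real m)\<^sup>2 * s ^ k) * E y + s ^ k * V y)))
        sums (\<epsilon> + K * ((V x + (1 / real m)\<^sup>2 * E x) * E y + E x * V y))"
      by (simp add: P_def algebra_simps)
  qed
  then show ?thesis
    unfolding P_def E_def V_def .
qed

text \<open>For \<open>m \<ge> 1\<close> the derivative is \<open>rate a m / m\<close> times the
  average \<open>S m\<close> of the scaled forward differences. The first factor tends to 1, and the
  moment bounds drive \<open>S m\<close> to \<open>g (x, y)\<close>.\<close>

lemma Yhat_derivative_x_tendsto:
  assumes a: "a > 1" and x: "x \<ge> 0" and y: "y \<ge> 0"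
    and bd: "\<And>u v. u \<ge> 0 \<Longrightarrow> v \<ge> 0 \<Longrightarrow> \<bar>f (u, v)\<bar> \<le> M * exp (u + v)"
    and der: "\<And>u v. u \<ge> 0 \<Longrightarrow> v \<ge> 0 \<Longrightarrow>
      ((\<lambda>t. f (t, v)) has_field_derivative g (u, v)) (at u within {0..})"
    and cont: "continuous_on quadrant g"
    and bd': "\<And>u v. u \<ge> 0 \<Longrightarrow> v \<ge> 0 \<Longrightarrow> \<bar>g (u, v)\<bar> \<le> M' * exp (u + v)"
  shows "(\<lambda>m. deriv (\<lambda>t. Yhat m a f (t, y)) x) \<longlonglongrightarrow> g (x, y)"
proof -
  define q where "q m k l = real m *
    (f (real (Suc k) / real m, real l / real m) - f (real k / real m, real l / real m))" for m k l
  define S where "S m = (\<Sum>k. poisson (rate a m * x) k * (\<Sum>l. poisson (rate a m * y) l * q m k l))" for m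
  have "S \<longlonglongrightarrow> g (x, y)"
  proof (rule tendstoI)
    fix e :: real
    assume "e > 0"
    \<comment> \<open>Half of \<open>e\<close> is spent on the local error; the other half is left
      for the moment terms, which tend to 0.\<close>
    then have "e / 2 > 0"
      by simp
    then obtain K where K: "K \<ge> 0" and est: "\<And>u v. u \<ge> 0 \<Longrightarrow> v \<ge> 0 \<Longrightarrow>
       \<bar>g (u, v) - g (x, y)\<bar> \<le> e / 2 + K * ((u - x)\<^sup>2 + (v - y)\<^sup>2) * exp (u + v)"
      using exp_growth_local_estimate[OF cont x y _ bd'] by blast
    define R where "R m = e / 2 + 2 * K * exp 1 *
      ((exp_second_moment a m x + (1 / real m)\<^sup>2 * exp_moment a m x) * exp_moment a m y
       + exp_moment a m x * exp_second_moment a m y)" for m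
    have S: "\<bar>S m - g (x, y)\<bar> \<le> R m" if "m \<ge> 1" for m
      unfolding S_def R_def q_def
      by (rule iterated_poisson_average_estimate[OF a that x y])
        (rule forward_difference_estimate[OF that], use K in \<open>auto intro: der est\<close>)
    have i: "((\<lambda>m. 1 / real m) \<longlongrightarrow> 0) at_top"
      by real_asymp
    have "R \<longlonglongrightarrow> e / 2 + 2 * K * exp 1 * ((0 + 0\<^sup>2 * exp x) * exp y + exp x * 0)"
      unfolding R_def
      by (intro tendsto_intros exp_moment_tendsto exp_second_moment_tendsto a i)
    then have "eventually (\<lambda>m. R m < e) sequentially"
      by (rule order_tendstoD) (use \<open>e > 0\<close> in simp)
    then show "eventually (\<lambda>m. dist (S m) (g (x, y)) < e) sequentially"
      using eventually_ge_at_top[of 1]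
      by eventually_elim (use S in \<open>fastforce simp: dist_real_def\<close>)
  qed
  then have "(\<lambda>m. rate a m / real m * S m) \<longlonglongrightarrow> g (x, y)"
    using tendsto_mult[OF rate_over_index_tendsto[OF a]] by fastforce
  moreover have "eventually (\<lambda>m. rate a m / real m * S m = deriv (\<lambda>t. Yhat m a f (t, y)) x) sequentially"
    using eventually_ge_at_top[of 1]
  proof eventually_elim
    case (elim m)
    have diff: "f (real (Suc k) / real m, real l / real m) - f (real k / real m, real l / real m)
        = 1 / real m * q m k l" for k l
      using elim by (simp add: q_def)
    define s where "s = exp (1 / real m)"
    \<comment> \<open>Pulling \<open>1 / m\<close> out of both sums requires their summability,
      hence geometric bounds for \<open>q\<close> and for its inner averages.\<close>
    have bdq: "\<bar>q m k l\<bar> \<le> (real m * (M * s ^ Suc k + M * s ^ k)) * s ^ l" for k l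
    proof -
      have "\<bar>q m k l\<bar> \<le> real m * (M * s ^ Suc k * s ^ l + M * s ^ k * s ^ l)"
        using exp_growth_grid[OF bd, of "Suc k" m l] exp_growth_grid[OF bd, of k m l]
        unfolding q_def abs_mult s_def by (intro mult_mono) auto
      then show ?thesis
        by (simp add: algebra_simps)
    qed
    have in_le: "\<bar>\<Sum>l. poisson (rate a m * y) l * q m k l\<bar> \<le>
        (real m * (M * s + M) * exp (rate a m * y * (s - 1))) * s ^ k" for k
      using poisson_average_bound[OF _ bdq, of "rate a m * y" k] rate_nonneg[OF a elim] y
      by (simp add: algebra_simps)
    have "(\<Sum>l. poisson (rate a m * y) l *
       (f (real (Suc k) / real m, real l / real m) - f (real k / real m, real l / real m)))
      = 1 / real m * (\<Sum>l. poisson (rate a m * y) l * q m k l)" for k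
      unfolding diff
      using suminf_mult[OF summable_poisson[OF bdq], of "1 / real m" "rate a m * y" k] by (simp add: mult_ac)
    then have "(\<Sum>k. poisson (rate a m * x) k * (\<Sum>l. poisson (rate a m * y) l *
       (f (real (Suc k) / real m, real l / real m) - f (real k / real m, real l / real m))))
      = (\<Sum>k. 1 / real m * (poisson (rate a m * x) k * (\<Sum>l. poisson (rate a m * y) l * q m k l)))"
      by (simp add: mult_ac)
    also have "\<dots> = 1 / real m * S m"
      unfolding S_def by (rule suminf_mult[OF summable_poisson[OF in_le]])
    finally show ?case
      using DERIV_imp_deriv[OF Yhat_has_derivative_x[OF a elim y bd, of x]] by simp
  qed
  ultimately show ?thesis
    by (rule Lim_transform_eventually)
qed

section \<open>Exponential growth in the weighted spaces\<close>

lemma one_plus_power_le_exp: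
  fixes u :: real
  assumes "u \<ge> 0"
  shows "1 + u ^ N \<le> (1 + fact N) * exp u"
proof -
  have "(\<lambda>n. u ^ n /\<^sub>R fact n) sums exp u"
    by (rule exp_converges)
  then have "u ^ N /\<^sub>R fact N \<le> exp u"
    using sum_le_suminf[of "\<lambda>n. u ^ n /\<^sub>R fact n" "{N}"] assms by (auto simp: sums_iff)
  then have "u ^ N \<le> fact N * exp u"
    by (simp add: field_simps)
  moreover have "1 \<le> exp u"
    using assms by simp
  ultimately show ?thesis
    unfolding distrib_right mult_1_left by linarith
qed

text \<open>Boundedness after weighting means polynomial growth, and each power is dominated by the
  exponential. The weaker exponential bound has the same form for all \<open>N1\<close> and
  \<open>N2\<close> and is geometric on the grid.\<close>

lemma weighted_C_exp_growth:
  assumes "f \<in> weighted_C N1 N2"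
  obtains M where "\<And>u v. u \<ge> 0 \<Longrightarrow> v \<ge> 0 \<Longrightarrow> \<bar>f (u, v)\<bar> \<le> M * exp (u + v)"
proof -
  obtain B where B: "\<And>p. p \<in> quadrant \<Longrightarrow> \<bar>weight2 N1 N2 p * f p\<bar> \<le> B"
    using assms by (auto simp: weighted_C_def bounded_iff)
  have w: "weight N u > 0" "1 / weight N u \<le> (1 + fact N) * exp u" if "u \<ge> 0" for N and u :: real
  proof -
    \<comment> \<open>This covers \<open>N = 0\<close>, where the reciprocal weight is 1 and not
      \<open>1 + u ^ 0 = 2\<close>.\<close>
    have "1 \<le> (1 + fact N) * exp u"
      using one_plus_power_le_exp[OF that, of N] zero_le_power[OF that, of N] by linarith
    then show "weight N u > 0" "1 / weight N u \<le> (1 + fact N) * exp u"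
      using one_plus_power_le_exp[OF that, of N] that
      by (auto simp: weight_def inverse_eq_divide add_pos_nonneg)
  qed
  show ?thesis
  proof
    fix u v :: real
    assume uv: "u \<ge> 0" "v \<ge> 0"
    have "weight N1 u * weight N2 v * \<bar>f (u, v)\<bar> \<le> B"
      using B[of "(u, v)"] uv w(1)[OF uv(1), of N1] w(1)[OF uv(2), of N2]
      by (simp add: quadrant_def weight2_def abs_mult)
    then have "\<bar>f (u, v)\<bar> \<le> B * (1 / weight N1 u * (1 / weight N2 v))"
      using w(1)[OF uv(1), of N1] w(1)[OF uv(2), of N2] by (simp add: field_simps)
    also have "B \<ge> 0"
      using B[of "(0, 0)"] by (simp add: quadrant_def)
    then have "B * (1 / weight N1 u * (1 / weight N2 v)) \<le>
        B * (((1 + fact N1) * exp u) * ((1 + fact N2) * exp v))"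
      using w[OF uv(1), of N1] w[OF uv(2), of N2] by (intro mult_left_mono mult_mono) auto
    finally show "\<bar>f (u, v)\<bar> \<le> (B * (1 + fact N1) * (1 + fact N2)) * exp (u + v)"
      by (simp add: exp_add mult_ac)
  qed
qed

text \<open>Ensures that derivatives within \<open>{0..}\<close> are unique, also at the boundary
  point 0.\<close>

lemma at_within_Ici_neq_bot:
  fixes x :: real
  assumes "x \<ge> 0"
  shows "at x within {0..} \<noteq> bot"
proof -
  have "x islimpt {0..x + 1}"
    using assms by (simp add: islimpt_Icc)
  then have "x islimpt {0..}"
    by (rule islimpt_subset) auto
  then show ?thesis
    by (simp add: trivial_limit_within)
qed

text \<open>The operator has a two-sided derivative in its first variable; restricted to
  \<open>{0..}\<close> it is identified with \<open>partial_x\<close> by uniqueness, and the limit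
  carries over.\<close>

lemma weighted_C1_x:
  assumes f: "f \<in> weighted_C N1 N2" and dx: "partial_x f \<in> weighted_C N1 N2"
    and diff: "\<And>p. p \<in> quadrant \<Longrightarrow> has_partial_x f p"
    and a: "a > 1" and xy: "x \<ge> 0" "y \<ge> 0"
  shows "(\<forall>m\<ge>1. has_partial_x (Yhat m a f) (x, y)) \<and>
    (\<lambda>m. partial_x (Yhat m a f) (x, y)) \<longlonglongrightarrow> partial_x f (x, y)"
proof -
  obtain M where bd: "\<And>u v. u \<ge> 0 \<Longrightarrow> v \<ge> 0 \<Longrightarrow> \<bar>f (u, v)\<bar> \<le> M * exp (u + v)"
    using weighted_C_exp_growth[OF f] by blast
  obtain M' where bd': "\<And>u v. u \<ge> 0 \<Longrightarrow> v \<ge> 0 \<Longrightarrow> \<bar>partial_x f (u, v)\<bar> \<le> M' * exp (u + v)"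
    using weighted_C_exp_growth[OF dx] by blast
  have cont: "continuous_on quadrant (partial_x f)"
    using dx by (simp add: weighted_C_def)
  have der: "((\<lambda>t. f (t, v)) has_field_derivative partial_x f (u, v)) (at u within {0..})"
    if "u \<ge> 0" "v \<ge> 0" for u v
    using diff[of "(u, v)"] that
    by (simp add: quadrant_def has_partial_x_def partial_x_def vector_derivative_works
        has_real_derivative_iff_has_vector_derivative)
  have derY: "((\<lambda>t. Yhat m a f (t, y)) has_real_derivative deriv (\<lambda>t. Yhat m a f (t, y)) x) (at x within {0..})"
    if "m \<ge> 1" for m
    using has_field_derivative_at_within[OF Yhat_has_derivative_x[OF a that xy(2) bd, of x]]
      DERIV_imp_deriv[OF Yhat_has_derivative_x[OF a that xy(2) bd, of x]]
    by simp
  have 1: "has_partial_x (Yhat m a f) (x, y)" if "m \<ge> 1" for m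
    using derY[OF that] unfolding has_partial_x_def prod.case
    by (auto simp: real_differentiable_def)
  have 2: "partial_x (Yhat m a f) (x, y) = deriv (\<lambda>t. Yhat m a f (t, y)) x" if "m \<ge> 1" for m
    using vector_derivative_within[OF at_within_Ici_neq_bot[OF xy(1)]] derY[OF that]
    by (simp add: partial_x_def has_real_derivative_iff_has_vector_derivative)
  have "(\<lambda>m. deriv (\<lambda>t. Yhat m a f (t, y)) x) \<longlonglongrightarrow> partial_x f (x, y)"
    by (rule Yhat_derivative_x_tendsto[OF a xy bd der cont bd'])
  then have "(\<lambda>m. partial_x (Yhat m a f) (x, y)) \<longlonglongrightarrow> partial_x f (x, y)"
    by (rule Lim_transform_eventually)
      (use 2 in \<open>auto simp: eventually_sequentially intro!: exI[of _ 1]\<close>)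
  with 1 show ?thesis
    by blast
qed

section \<open>Exchange of the two variables\<close>

text \<open>The coordinate swap is an isometry that maps the quadrant onto itself and exchanges the
  two weights.\<close>

lemma weighted_C_swap:
  assumes "f \<in> weighted_C N1 N2"
  shows "(\<lambda>(u, v). f (v, u)) \<in> weighted_C N2 N1"
proof -
  have sw: "prod.swap ` quadrant = quadrant"
    by (auto simp: quadrant_def)
  have eq: "(\<lambda>(u, v). h (v, u)) = h \<circ> prod.swap" for h :: "real \<times> real \<Rightarrow> real"
    by auto
  have uc: "uniformly_continuous_on quadrant (prod.swap :: real \<times> real \<Rightarrow> _)"
    unfolding uniformly_continuous_on_def
    by (auto simp: dist_prod_def add.commute)
  have w: "(\<lambda>p. weight2 N2 N1 p * (f \<circ> prod.swap) p) = (\<lambda>p. weight2 N1 N2 p * f p) \<circ> prod.swap"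
    by (auto simp: weight2_def)
  have f: "continuous_on quadrant f" "uniformly_continuous_on quadrant (\<lambda>p. weight2 N1 N2 p * f p)"
      "bounded ((\<lambda>p. weight2 N1 N2 p * f p) ` quadrant)"
    using assms by (auto simp: weighted_C_def)
  have "continuous_on quadrant (f \<circ> prod.swap)"
    by (intro continuous_on_compose uniformly_continuous_imp_continuous[OF uc]) (simp add: sw f)
  moreover have "uniformly_continuous_on quadrant ((\<lambda>p. weight2 N1 N2 p * f p) \<circ> prod.swap)"
    unfolding o_def
    by (rule uniformly_continuous_on_compose[OF uc]) (simp only: sw f)
  moreover have "bounded (((\<lambda>p. weight2 N1 N2 p * f p) \<circ> prod.swap) ` quadrant)"
    by (simp only: image_comp[symmetric] sw f)
  ultimately show ?thesis
    unfolding weighted_C_def mem_Collect_eq eq w by blast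
qed

theorem theorem5p1:
  fixes a :: real and N1 N2 :: nat and f :: "real \<times> real \<Rightarrow> real"
  assumes "a > 1" and "f \<in> weighted_C1 N1 N2"
  shows "\<forall>p\<in>quadrant.
     (\<forall>m\<ge>1. has_partial_x (Yhat m a f) p \<and> has_partial_y (Yhat m a f) p) \<and>
     (\<lambda>m. partial_x (Yhat m a f) p) \<longlonglongrightarrow> partial_x f p \<and>
     (\<lambda>m. partial_y (Yhat m a f) p) \<longlonglongrightarrow> partial_y f p"
proof
  fix p :: "real \<times> real"
  assume "p \<in> quadrant"
  then obtain x y where p: "p = (x, y)" and xy: "x \<ge> 0" "y \<ge> 0"
    by (auto simp: quadrant_def)
  \<comment> \<open>Reflection in the diagonal turns derivatives of \<open>f\<close> in the second
    variable into derivatives of \<open>f'\<close> in the first.\<close>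
  define f' where "f' = (\<lambda>(u, v). f (v, u))"
  have f: "f \<in> weighted_C N1 N2" "partial_x f \<in> weighted_C N1 N2" "partial_y f \<in> weighted_C N1 N2"
      "\<And>p. p \<in> quadrant \<Longrightarrow> has_partial_x f p" "\<And>p. p \<in> quadrant \<Longrightarrow> has_partial_y f p"
    using assms(2) by (auto simp: weighted_C1_def)
  obtain M where bd: "\<And>u v. u \<ge> 0 \<Longrightarrow> v \<ge> 0 \<Longrightarrow> \<bar>f (u, v)\<bar> \<le> M * exp (u + v)"
    using weighted_C_exp_growth[OF f(1)] by blast
  have px: "partial_x f' = (\<lambda>(u, v). partial_y f (v, u))"
    by (auto simp: partial_x_def partial_y_def f'_def)
  have f': "f' \<in> weighted_C N2 N1" "partial_x f' \<in> weighted_C N2 N1"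
    unfolding px unfolding f'_def by (intro weighted_C_swap f)+
  have "has_partial_x f' p" if "p \<in> quadrant" for p
    using f(5)[of "prod.swap p"] that
    by (auto simp: quadrant_def has_partial_x_def has_partial_y_def f'_def)
  note Y' = weighted_C1_x[OF f' this assms(1) xy(2,1)]
  \<comment> \<open>Equality for all real \<open>t\<close>, not only at \<open>y\<close>, transfers
    derivatives and not just values.\<close>
  have "Yhat m a f (x, t) = Yhat m a f' (t, x)" if "m \<ge> 1" for m t
    unfolding f'_def by (rule Yhat_swap[OF assms(1) that bd, symmetric])
  then have "has_partial_y (Yhat m a f) (x, y) = has_partial_x (Yhat m a f') (y, x)"
      "partial_y (Yhat m a f) (x, y) = partial_x (Yhat m a f') (y, x)" if "m \<ge> 1" for m
    using that by (auto simp: has_partial_y_def has_partial_x_def partial_x_def partial_y_def)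
  note eq = this
  have "(\<lambda>m. partial_y (Yhat m a f) (x, y)) \<longlonglongrightarrow> partial_y f (x, y)"
    by (rule Lim_transform_eventually[of "\<lambda>m. partial_x (Yhat m a f') (y, x)"])
      (use Y' eq in \<open>auto simp: px eventually_sequentially intro!: exI[of _ 1]\<close>)
  then show "(\<forall>m\<ge>1. has_partial_x (Yhat m a f) p \<and> has_partial_y (Yhat m a f) p) \<and>
     (\<lambda>m. partial_x (Yhat m a f) p) \<longlonglongrightarrow> partial_x f p \<and>
     (\<lambda>m. partial_y (Yhat m a f) p) \<longlonglongrightarrow> partial_y f p"
    using weighted_C1_x[OF f(1,2,4) assms(1) xy] Y' eq unfolding p by blast
qed

end
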